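(* For every three-dimensional rotating black hole metric as in the context and every scalar mass $m$, the pole-skipping data at orders $n=1,2,3,4$ satisfy the following polynomial constraints. Order $n=2$: $$E_2(k)-4E_1(k)=0.$$ Order $n=3$: $$E_3(k)-9E_1(k)=0,$$ $$E_3(k^2)-4E_2(k^2)-11E_1(k)^2+5E_1(k^2)=0,$$ $$E_3(k^3)-6E_2(k^3)-12E_1(k)E_2(k^2)+30E_1(k)E_1(k^2)+21E_1(k)^3=0.$$ Order $n=4$: $$E_4(k)-16E_1(k)=0,$$ $$E_4(k^2)-10E_2(k^2)-56E_1(k)^2+16E_1(k^2)=0,$$ $$E_4(k^3)-20E_2(k^3)+192E_1(k)E_1(k^2)-80E_1(k)E_2(k^2)+64E_1(k)^3=0,$$ $$\begin{aligned}&E_4(k^4)-6E_3(k^4)+40E_1(k^2)E_2(k^2)-9E_2(k^2)^2-52E_1(k)E_2(k^3)+14E_2(k^4)\\&+240E_1(k)^4+338E_1(k)^2E_1(k^2)-46E_1(k^2)^2-88E_1(k)^2E_2(k^2)=0,\end{aligned}$$ $$\begin{aligned}&E_4(k^5)-8E_3(k^5)-696E_1(k)^3E_1(k^2)-368E_1(k)E_1(k^2)^2+160E_1(k)E_1(k^2)E_2(k^2)+256E_1(k)^2E_2(k^3)\\&+80E_1(k^2)E_2(k^3)-36E_2(k^2)E_2(k^3)+112E_1(k)E_2(k^4)-24E_1(k)E_3(k^4)=0.\end{aligned}$$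
   Context: Metric: $ds^2=-\frac{f_1(z)}{z^2}dt^2+\frac{dz^2}{z^2f_2(z)}+\frac1{z^2}(d\varphi-f_3(z)dt)^2$, horizon at $z=1$, $f_a$ analytic near $z=1$, $f_1(1)=f_2(1)=0$, $f_3(1)=\Omega_H$, and $f_1'(1)f_2'(1)=(4\pi T)^2$ with $T>0$ the Hawking temperature. (No field equations are imposed on the metric.) A free scalar of mass $m$, $\Phi=e^{-i\omega t+ik\varphi}\psi(z)$, satisfies $A\psi''+B\psi'+C\psi=0$ with $A=f_1f_2$, $B=\frac12(f_1f_2)'-\frac{f_1f_2}{z}$, $C=(\omega-kf_3)^2-f_1\frac{k^2z^2+m^2}{z^2}$. Write $A_j,B_j,C_j$ for the coefficients of $(z-1)^j$ in $A,B,C$ (zero for $j<0$). Put $\mathfrak w=\omega-k\Omega_H$, $\rho=-i\mathfrak w/(4\pi T)$ and $$M_{KS}=A_{K-S+3}(\rho+S-1)(\rho+S-2)+B_{K-S+2}(\rho+S-1)+C_{K-S+1},$$ the coefficient of $\phi_{S-1}$ at order $(z-1)^{\rho+K}$ when $\psi=(z-1)^\rho\sum_j\phi_j(z-1)^j$ is inserted. At the pole-skipping frequency $\mathfrak w_n=-2\pi iTn$ (so $\rho=-n/2$, $\omega-kf_3=\mathfrak w_n-k(f_3-\Omega_H)$), $\det(M_{KS})_{1\le K,S\le n}$ is a polynomial in $k$ of degree $2n$; its roots (with multiplicity) are the order-$n$ pole-skipping momenta, and $E_n(k^l)$ denotes the elementary symmetric polynomial of degree $l$ in these $2n$ roots.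 *)

theory Defs
  imports
    "HOL-Complex_Analysis.Complex_Analysis"
    "HOL-Computational_Algebra.Computational_Algebra"
    "Jordan_Normal_Form.Determinant"
begin

text \<open>
  Metric \<open>ds\<^sup>2 = - f1(z)/z\<^sup>2 dt\<^sup>2 + dz\<^sup>2/(z\<^sup>2 f2(z)) + 1/z\<^sup>2 (d\<phi> - f3(z) dt)\<^sup>2\<close>.
  The metric functions are real-analytic in the real coordinate \<open>z\<close> near the horizon \<open>z = 1\<close>; they
  are represented by their holomorphic extensions to a complex neighbourhood of \<open>1\<close>.
\<close>

definition real_analytic_at :: "(complex \<Rightarrow> complex) \<Rightarrow> real \<Rightarrow> bool" where
  "real_analytic_at f x \<longleftrightarrow>
     f analytic_on {complex_of_real x} \<and> (\<forall>\<^sub>F y in nhds x. f (complex_of_real y) \<in> \<real>)"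

definition rotating_black_hole ::
  "(complex \<Rightarrow> complex) \<Rightarrow> (complex \<Rightarrow> complex) \<Rightarrow> (complex \<Rightarrow> complex) \<Rightarrow> complex \<Rightarrow> real \<Rightarrow> bool" where
  "rotating_black_hole f1 f2 f3 \<Omega>H T \<longleftrightarrow>
     real_analytic_at f1 1 \<and> real_analytic_at f2 1 \<and> real_analytic_at f3 1 \<and>
     f1 1 = 0 \<and> f2 1 = 0 \<and> f3 1 = \<Omega>H \<and>
     T > 0 \<and> deriv f1 1 * deriv f2 1 = complex_of_real ((4 * pi * T)\<^sup>2)"

text \<open>
  Radial equation \<open>A \<psi>'' + B \<psi>' + C \<psi> = 0\<close>, the Klein--Gordon equation of mass \<open>m\<close> for
  \<open>e\<^bsup>-i\<omega>t+ik\<phi>\<^esup> \<psi>(z)\<close> multiplied by \<open>f1/z\<^sup>2\<close>.  A complex \<open>m\<close> allows for negative \<open>m\<^sup>2\<close>.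
\<close>

definition KG_A :: "(complex \<Rightarrow> complex) \<Rightarrow> (complex \<Rightarrow> complex) \<Rightarrow> complex \<Rightarrow> complex" where
  "KG_A f1 f2 z = f1 z * f2 z"

definition KG_B :: "(complex \<Rightarrow> complex) \<Rightarrow> (complex \<Rightarrow> complex) \<Rightarrow> complex \<Rightarrow> complex" where
  "KG_B f1 f2 z = 1/2 * deriv (\<lambda>x. f1 x * f2 x) z - f1 z * f2 z / z"

definition KG_C ::
  "(complex \<Rightarrow> complex) \<Rightarrow> (complex \<Rightarrow> complex) \<Rightarrow> complex \<Rightarrow> complex \<Rightarrow> complex \<Rightarrow> complex \<Rightarrow> complex" where
  "KG_C f1 f3 m \<omega> k z = (\<omega> - k * f3 z)\<^sup>2 - f1 z * ((k\<^sup>2 * z\<^sup>2 + m\<^sup>2) / z\<^sup>2)"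

definition taylor_coeff :: "(complex \<Rightarrow> complex) \<Rightarrow> int \<Rightarrow> complex" where
  "taylor_coeff g j = (if j < 0 then 0 else fps_nth (fps_expansion g 1) (nat j))"

definition KG_M ::
  "(complex \<Rightarrow> complex) \<Rightarrow> (complex \<Rightarrow> complex) \<Rightarrow> (complex \<Rightarrow> complex) \<Rightarrow> complex \<Rightarrow> real \<Rightarrow>
   complex \<Rightarrow> complex \<Rightarrow> complex \<Rightarrow> nat \<Rightarrow> nat \<Rightarrow> complex" where
  "KG_M f1 f2 f3 \<Omega>H T m \<omega> k K S =
     (let \<ww> = \<omega> - k * \<Omega>H;
          \<rho> = - \<i> * \<ww> / (4 * pi * T)
      in taylor_coeff (KG_A f1 f2) (int K - int S + 3) * (\<rho> + of_nat S - 1) * (\<rho> + of_nat S - 2)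
       + taylor_coeff (KG_B f1 f2) (int K - int S + 2) * (\<rho> + of_nat S - 1)
       + taylor_coeff (KG_C f1 f3 m \<omega> k) (int K - int S + 1))"

definition ps_freq :: "complex \<Rightarrow> real \<Rightarrow> nat \<Rightarrow> complex \<Rightarrow> complex" where
  "ps_freq \<Omega>H T n k = - 2 * pi * \<i> * T * of_nat n + k * \<Omega>H"

text \<open>Rows and columns of the matrices of \<open>Jordan_Normal_Form\<close> are numbered from \<open>0\<close>.\<close>

definition ps_det ::
  "(complex \<Rightarrow> complex) \<Rightarrow> (complex \<Rightarrow> complex) \<Rightarrow> (complex \<Rightarrow> complex) \<Rightarrow> complex \<Rightarrow> real \<Rightarrow>
   complex \<Rightarrow> nat \<Rightarrow> complex \<Rightarrow> complex" where
  "ps_det f1 f2 f3 \<Omega>H T m n k =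
     Determinant.det (Matrix.mat n n
       (\<lambda>(i, j). KG_M f1 f2 f3 \<Omega>H T m (ps_freq \<Omega>H T n k) k (Suc i) (Suc j)))"

text \<open>
  For a metric as above, the determinant is a polynomial function of \<open>k\<close> of degree \<open>2n\<close> (the
  coefficient of \<open>k\<^sup>2\<^sup>n\<close> is \<open>(- deriv f1 1) ^ n\<close>), and over the complex numbers its values determine
  the polynomial.
\<close>

definition ps_poly ::
  "(complex \<Rightarrow> complex) \<Rightarrow> (complex \<Rightarrow> complex) \<Rightarrow> (complex \<Rightarrow> complex) \<Rightarrow> complex \<Rightarrow> real \<Rightarrow>
   complex \<Rightarrow> nat \<Rightarrow> complex poly" where
  "ps_poly f1 f2 f3 \<Omega>H T m n = (THE p. \<forall>k. poly p k = ps_det f1 f2 f3 \<Omega>H T m n k)"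

text \<open>The \<open>l\<close>-element submultisets are counted with multiplicity: an element \<open>x\<close> of \<open>X\<close> is
  split into the distinct copies \<open>(x, 0), \<dots>, (x, count X x - 1)\<close>.\<close>

definition elem_sym :: "nat \<Rightarrow> 'a :: comm_semiring_1 multiset \<Rightarrow> 'a" where
  "elem_sym l X =
     (\<Sum>I | I \<subseteq> (SIGMA x:set_mset X. {..<count X x}) \<and> card I = l. \<Prod>(x, i)\<in>I. x)"

definition ps_E ::
  "(complex \<Rightarrow> complex) \<Rightarrow> (complex \<Rightarrow> complex) \<Rightarrow> (complex \<Rightarrow> complex) \<Rightarrow> complex \<Rightarrow> real \<Rightarrow>
   complex \<Rightarrow> nat \<Rightarrow> nat \<Rightarrow> complex" where
  "ps_E f1 f2 f3 \<Omega>H T m n l = elem_sym l (proots (ps_poly f1 f2 f3 \<Omega>H T m n))"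

end

theory Submission
  imports Defs
begin

text \<open>
  Let \<open>\<tau> = 4 \<pi> T\<close>.  Since \<open>A\<close> vanishes to second order at the horizon and \<open>B = A'/2 - A/z\<close>, the
  coordinate \<open>y\<close> with \<open>\<surd>A d/dz = \<tau> y d/dy\<close> and the substitution \<open>\<psi> = z\<^bsup>1/2\<^esup> \<chi>\<close> turn the radial
  equation into \<open>(y d/dy)\<^sup>2 \<chi> + V(y) \<chi> = 0\<close>.  The term added to \<open>C\<close> depends neither on the order
  \<open>n\<close> nor on \<open>k\<close>, so the coefficients of \<open>V\<close> beyond the constant one \<open>- n\<^sup>2/4\<close> have the form
  \<open>V\<^sub>d = p\<^sub>d + n q\<^sub>d k + r\<^sub>d k\<^sup>2\<close> with \<open>p, q, r\<close> independent of \<open>n\<close>.  The change of variables does not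
  alter the determinant, which is now a short weighted homogeneous polynomial in \<open>V\<^sub>1, \<dots>, V\<^sub>n\<close>;
  rescaling \<open>y\<close> achieves \<open>r\<^sub>1 = 1\<close>.  By Vieta, the \<open>E\<^sub>n(k\<^sup>l)\<close> are then explicit polynomials in
  \<open>p, q, r\<close>, and the constraints are identities between them.
\<close>

section \<open>Vieta's formulas for \<open>elem_sym\<close> and \<open>ps_E\<close>\<close>

lemma image_prod_mset_conv_prod_copies:
  "(\<Prod>x\<in>#X. g x) = (\<Prod>(x, i)\<in>(SIGMA x:set_mset X. {..<count X x}). g x)"
  by (subst prod.Sigma [symmetric]) (simp_all add: image_prod_mset_multiplicity)

text \<open>Expanding the product means choosing the set \<open>I\<close> of copies that contribute
  \<open>-x\<close>, while the other factors contribute the variable. The power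
  \<open>size X - l\<close> then belongs to \<open>card I = l\<close>.\<close>

lemma coeff_prod_linear_factors:
  fixes X :: "'a :: comm_ring_1 multiset"
  assumes "l \<le> size X"
  shows "coeff (\<Prod>x\<in>#X. [:-x, 1:]) (size X - l) = (-1) ^ l * elem_sym l X"
proof -
  define Z where "Z = (SIGMA x:set_mset X. {..<count X x})"
  have fin: "finite Z"
    by (simp add: Z_def)
  have cardZ: "card Z = size X"
    by (simp add: Z_def size_multiset_overloaded_eq)
  have fact: "[:-x, 1:] = [:-x:] + monom 1 1" for x :: 'a
    by (simp add: monom_altdef)
  have const: "(\<Prod>z\<in>I. [:-fst z:]) = [:(-1) ^ card I * (\<Prod>z\<in>I. fst z):]" if "I \<subseteq> Z" for I
    using finite_subset[OF that fin] by (induction I rule: finite_induct) (simp_all add: one_pCons mult_ac)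
  have "(\<Prod>x\<in>#X. [:-x, 1:]) = (\<Prod>z\<in>Z. [:-fst z:] + monom 1 1)"
    unfolding image_prod_mset_conv_prod_copies Z_def [symmetric] fact by (simp add: case_prod_unfold)
  also have "\<dots> = (\<Sum>I\<in>Pow Z. (\<Prod>z\<in>I. [:-fst z:]) * (\<Prod>z\<in>Z - I. monom 1 1))"
    by (rule prod_add[OF fin])
  also have "\<dots> = (\<Sum>I\<in>Pow Z. monom ((-1) ^ card I * (\<Prod>z\<in>I. fst z)) (card Z - card I))"
  proof (intro sum.cong refl)
    fix I assume "I \<in> Pow Z"
    then have "I \<subseteq> Z" by simp
    then show "(\<Prod>z\<in>I. [:-fst z:]) * (\<Prod>z\<in>Z - I. monom 1 1) =
        monom ((-1) ^ card I * (\<Prod>z\<in>I. fst z)) (card Z - card I)"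
      by (simp add: const monom_power smult_monom card_Diff_subset finite_subset[OF _ fin])
  qed
  also have "coeff \<dots> (size X - l) =
      (\<Sum>I\<in>Pow Z. if card I = l then (-1) ^ card I * (\<Prod>z\<in>I. fst z) else 0)"
    unfolding coeff_sum coeff_monom
  proof (intro sum.cong refl)
    fix I assume "I \<in> Pow Z"
    then have "card I \<le> card Z" by (simp add: card_mono fin)
    then show "(if card Z - card I = size X - l then (-1) ^ card I * (\<Prod>z\<in>I. fst z) else 0) =
        (if card I = l then (-1) ^ card I * (\<Prod>z\<in>I. fst z) else 0)"
      \<comment> \<open>Truncated subtraction is injective here, as \<open>card I\<close> and
        \<open>l\<close> are both at most \<open>card Z\<close>.\<close>
      using assms cardZ by auto
  qed
  also have "\<dots> = (\<Sum>I | I \<subseteq> Z \<and> card I = l. (-1) ^ card I * (\<Prod>z\<in>I. fst z))"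
    by (rule sum.mono_neutral_cong_right) (auto simp: fin)
  also have "\<dots> = (-1) ^ l * elem_sym l X"
    unfolding elem_sym_def Z_def [symmetric] sum_distrib_left
    by (rule sum.cong) (auto simp: case_prod_unfold)
  finally show ?thesis .
qed

lemma elem_sym_proots:
  fixes p :: "complex poly"
  assumes "lead_coeff p = 1" "l \<le> degree p"
  shows "elem_sym l (proots p) = (-1) ^ l * coeff p (degree p - l)"
proof -
  have "coeff p (degree p - l) = (-1) ^ l * elem_sym l (proots p)"
    using coeff_prod_linear_factors[of l "proots p"] complex_poly_decompose_multiset[of p] assms
    by (simp add: size_proots_complex)
  then show ?thesis
    by (simp add: power_mult_distrib [symmetric] mult.assoc [symmetric])
qed

text \<open>A complex polynomial is determined by its values, so the description in
  \<open>ps_poly\<close> picks out \<open>smult c p\<close>; the factor \<open>c\<close> leaves the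
  roots unchanged.\<close>

lemma ps_E_eq:
  fixes p :: "complex poly"
  assumes "c \<noteq> 0" "\<And>k. ps_det f1 f2 f3 \<Omega>H T m n k = c * poly p k"
    and "lead_coeff p = 1" "l \<le> degree p"
  shows "ps_E f1 f2 f3 \<Omega>H T m n l = (-1) ^ l * coeff p (degree p - l)"
proof -
  have "ps_poly f1 f2 f3 \<Omega>H T m n = Polynomial.smult c p"
    unfolding ps_poly_def assms(2)
  proof (rule the_equality)
    fix q assume "\<forall>k. poly q k = c * poly p k"
    then have "poly q = poly (Polynomial.smult c p)" by auto
    then show "q = Polynomial.smult c p" by (simp only: poly_eq_poly_eq_iff)
  qed simp
  then show ?thesis
    using assms by (simp add: ps_E_def elem_sym_proots)
qed

section \<open>Small determinants and the Frobenius matrix of the radial equation\<close>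

text \<open>The minors are again of the form \<open>Matrix.mat\<close>, so rewriting iterates down
  to explicit formulas.\<close>

lemma det_mat_Suc:
  fixes f :: "nat \<times> nat \<Rightarrow> 'a :: comm_ring_1"
  shows "Determinant.det (Matrix.mat (Suc n) (Suc n) f) =
    (\<Sum>j<Suc n. f (0, j) * ((-1) ^ j * Determinant.det
      (Matrix.mat n n (\<lambda>(a, b). f (Suc a, if b < j then b else Suc b)))))"
proof -
  have "mat_delete (Matrix.mat (Suc n) (Suc n) f) 0 j =
      Matrix.mat n n (\<lambda>(a, b). f (Suc a, if b < j then b else Suc b))" if "j < Suc n" for j
    using that by (intro eq_matI) (auto simp: mat_delete_def)
  then show ?thesis
    by (subst laplace_expansion_row[of _ "Suc n" 0]) (auto simp: cofactor_def intro!: sum.cong)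
qed

text \<open>
  The matrix \<open>M / \<tau>\<^sup>2\<close> at \<open>\<rho> = -n/2\<close> with indices from \<open>0\<close>, where \<open>\<tau>\<^sup>2 a\<^sub>d = A\<^bsub>d+2\<^esub>\<close>, \<open>\<tau>\<^sup>2 c\<^sub>d = C\<^sub>d\<close> and
  \<open>\<tau>\<^sup>2 h\<^sub>d\<close> is the coefficient of \<open>(z-1)\<^bsup>d+1\<^esup>\<close> in \<open>A/z\<close>.
\<close>

definition frob_entry ::
  "(nat \<Rightarrow> complex) \<Rightarrow> (nat \<Rightarrow> complex) \<Rightarrow> (nat \<Rightarrow> complex) \<Rightarrow> nat \<Rightarrow> nat \<Rightarrow> nat \<Rightarrow> complex" where
  "frob_entry a h c n i j = (if Suc i < j then 0 else
     (let d = Suc i - j; \<sigma> = of_nat j - of_nat n / 2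
      in a d * \<sigma> * (\<sigma> - 1) + (of_nat (d + 2) / 2 * a d - h d) * \<sigma> + c d))"

lemma taylor_coeff_eqI:
  assumes "(\<lambda>x. g (1 + x)) has_fps_expansion G"
  shows "taylor_coeff g j = (if j < 0 then 0 else fps_nth G (nat j))"
proof -
  have "fps_expansion g 1 = fps_expansion (\<lambda>x. g (1 + x)) 0"
    by (simp add: fps_expansion_def higher_deriv_shift_0'[of 1] o_def)
  then show ?thesis
    using fps_expansion_eqI[OF assms] by (simp add: taylor_coeff_def)
qed

text \<open>The witnesses are fixed before \<open>n\<close> and \<open>k\<close>, which makes
  different orders comparable. A term linear in \<open>k\<close> arises only as the cross term of
  the square in \<open>KG_C\<close>, whose frequency part is proportional to
  \<open>n\<close>.\<close>

lemma KG_M_eq_frob_entry: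
  assumes "rotating_black_hole f1 f2 f3 \<Omega>H T"
  obtains a h p q r :: "nat \<Rightarrow> complex" and t :: complex
  where "t \<noteq> 0" "a 0 = 1" "h 0 = 0" "\<And>d. h (Suc d) = a d - h d" "r 1 \<noteq> 0"
    "\<And>n k i j. KG_M f1 f2 f3 \<Omega>H T m (ps_freq \<Omega>H T n k) k (Suc i) (Suc j) =
       t * frob_entry a h
         (\<lambda>d. if d = 0 then - (of_nat n)\<^sup>2 / 4 else p d + of_nat n * q d * k + r d * k\<^sup>2) n i j"
proof -
  note ex = analytic_at_imp_has_fps_expansion [of _ "1 :: complex"]
  define \<tau> :: complex where "\<tau> = 4 * pi * T"
  have T: "T > 0" and \<tau>0: "\<tau> \<noteq> 0"
    using assms by (auto simp: rotating_black_hole_def \<tau>_def)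
  define F1 F2 F3 where "F1 = fps_expansion f1 1" and "F2 = fps_expansion f2 1"
    and "F3 = fps_expansion f3 1"
  have F: "(\<lambda>x. f1 (1 + x)) has_fps_expansion F1" "(\<lambda>x. f2 (1 + x)) has_fps_expansion F2"
    "(\<lambda>x. f3 (1 + x)) has_fps_expansion F3"
    using assms ex by (auto simp: rotating_black_hole_def real_analytic_at_def F1_def F2_def F3_def)
  have F0: "fps_nth F1 0 = 0" "fps_nth F2 0 = 0" "fps_nth F3 0 = \<Omega>H"
    "fps_nth F1 1 * fps_nth F2 1 = \<tau>\<^sup>2"
    using assms by (auto simp: rotating_black_hole_def fps_expansion_def F1_def F2_def F3_def \<tau>_def)
  define A where "A = F1 * F2"
  define X where "X = inverse (1 + fps_X :: complex fps)"
  have X: "(\<lambda>x::complex. inverse (1 + x)) has_fps_expansion X"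
    unfolding X_def by (intro fps_expansion_intros) auto
  have A: "(\<lambda>x. KG_A f1 f2 (1 + x)) has_fps_expansion A"
    unfolding A_def KG_A_def by (intro fps_expansion_intros F)
  have B: "(\<lambda>x. KG_B f1 f2 (1 + x)) has_fps_expansion fps_const (1/2) * fps_deriv A - A * X"
  proof -
    have "deriv (\<lambda>x. f1 (1 + x) * f2 (1 + x)) has_fps_expansion fps_deriv A"
      using A unfolding KG_A_def by (rule has_fps_expansion_deriv)
    moreover have "deriv (\<lambda>x. f1 (1 + x) * f2 (1 + x)) = (\<lambda>x. deriv (\<lambda>y. f1 y * f2 y) (1 + x))"
    proof
      fix x
      show "deriv (\<lambda>x. f1 (1 + x) * f2 (1 + x)) x = deriv (\<lambda>y. f1 y * f2 y) (1 + x)"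
        using deriv_shift_0'[of "1 + x" "\<lambda>y. f1 y * f2 y"]
          deriv_shift_0'[of x "\<lambda>y. f1 (1 + y) * f2 (1 + y)"]
        by (simp add: o_def add_ac)
    qed
    ultimately have D: "(\<lambda>x. deriv (\<lambda>y. f1 y * f2 y) (1 + x)) has_fps_expansion fps_deriv A"
      by simp
    have A': "(\<lambda>x. f1 (1 + x) * f2 (1 + x)) has_fps_expansion A"
      using A by (simp add: KG_A_def)
    show ?thesis
      unfolding KG_B_def divide_inverse[of "f1 _ * f2 _"]
      by (intro fps_expansion_intros D A' X)
  qed
  define G where "G = F3 - fps_const \<Omega>H"
  define Y where "Y = G\<^sup>2 - F1"
  define N where "N = F1 * fps_const (m\<^sup>2) * X\<^sup>2"
  have C: "(\<lambda>x. KG_C f1 f3 m (ps_freq \<Omega>H T n k) k (1 + x)) has_fps_expansion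
      fps_const (- \<tau>\<^sup>2 * (of_nat n)\<^sup>2 / 4) + fps_const (\<i> * \<tau> * of_nat n * k) * G
      + fps_const (k\<^sup>2) * Y - N" for n k
  proof -
    \<comment> \<open>Clearing the denominator in \<open>KG_C\<close> requires \<open>1 + x\<close>
      to be nonzero; equality near \<open>x = 0\<close> suffices for the expansion.\<close>
    have ev: "\<forall>\<^sub>F x in nhds (0::complex). x \<noteq> -1"
      by (rule t1_space_nhds) simp
    have *: "(\<lambda>x. (ps_freq \<Omega>H T n k - k * f3 (1 + x))\<^sup>2
        - (f1 (1 + x) * k\<^sup>2 + f1 (1 + x) * m\<^sup>2 * (inverse (1 + x))\<^sup>2)) has_fps_expansion
      (fps_const (ps_freq \<Omega>H T n k) - fps_const k * F3)\<^sup>2 - (F1 * fps_const (k\<^sup>2) + N)"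
      unfolding N_def power2_eq_square[of "_ - _"] power2_eq_square[of "inverse _"] power2_eq_square[of X]
      by (intro fps_expansion_intros F X)
    have "(\<lambda>x. KG_C f1 f3 m (ps_freq \<Omega>H T n k) k (1 + x)) has_fps_expansion
      (fps_const (ps_freq \<Omega>H T n k) - fps_const k * F3)\<^sup>2 - (F1 * fps_const (k\<^sup>2) + N)"
    proof (subst has_fps_expansion_cong[OF _ refl])
      show "\<forall>\<^sub>F x in nhds 0. KG_C f1 f3 m (ps_freq \<Omega>H T n k) k (1 + x) =
        (ps_freq \<Omega>H T n k - k * f3 (1 + x))\<^sup>2
        - (f1 (1 + x) * k\<^sup>2 + f1 (1 + x) * m\<^sup>2 * (inverse (1 + x))\<^sup>2)"
        using ev
      proof eventually_elim
        case (elim x)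
        then have "1 + x \<noteq> 0" by (simp add: add_eq_0_iff)
        then show ?case by (simp add: KG_C_def field_simps)
      qed
    qed (rule *)
    moreover have "(fps_const (ps_freq \<Omega>H T n k) - fps_const k * F3)\<^sup>2 - (F1 * fps_const (k\<^sup>2) + N) =
      fps_const (- \<tau>\<^sup>2 * (of_nat n)\<^sup>2 / 4) + fps_const (\<i> * \<tau> * of_nat n * k) * G
      + fps_const (k\<^sup>2) * Y - N"
    proof -
      define w where "w = - (\<i> * \<tau> * of_nat n / 2)"
      have "fps_const (ps_freq \<Omega>H T n k) = fps_const w + fps_const k * fps_const \<Omega>H"
        by (simp add: w_def ps_freq_def \<tau>_def mult_ac)
      then have "(fps_const (ps_freq \<Omega>H T n k) - fps_const k * F3)\<^sup>2 = (fps_const w - fps_const k * G)\<^sup>2"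
        by (simp add: G_def algebra_simps)
      also have "\<dots> = fps_const (w\<^sup>2) + fps_const (-2 * w * k) * G + fps_const (k\<^sup>2) * G\<^sup>2"
        unfolding fps_const_power [symmetric] fps_const_mult [symmetric]
        by (simp add: power2_eq_square algebra_simps numeral_fps_const fps_const_neg [symmetric] del: fps_const_neg)
      also have "w\<^sup>2 = - \<tau>\<^sup>2 * (of_nat n)\<^sup>2 / 4"
        by (simp add: w_def power_mult_distrib power_divide)
      also have "-2 * w * k = \<i> * \<tau> * of_nat n * k"
        by (simp add: w_def)
      finally show ?thesis by (simp add: Y_def algebra_simps)
    qed
    ultimately show ?thesis by simp
  qed
  define a where "a d = fps_nth A (d + 2) / \<tau>\<^sup>2" for d
  define h where "h d = fps_nth (A * X) (d + 1) / \<tau>\<^sup>2" for d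
  have A01: "fps_nth A 0 = 0" "fps_nth A (Suc 0) = 0" "fps_nth A 2 = \<tau>\<^sup>2"
    using F0 by (simp_all add: A_def fps_mult_nth numeral_2_eq_2)
  have AX0: "fps_nth (A * X) 0 = 0"
    using A01 by simp
  have AX: "fps_nth (A * X) (Suc d) = fps_nth A (Suc d) - fps_nth (A * X) d" for d
  proof -
    \<comment> \<open>Multiplying the series of \<open>A/z\<close> by \<open>z = 1 + x\<close> gives
      the recurrence.\<close>
    have "A = A * (X * (1 + fps_X))"
      by (simp add: X_def inverse_mult_eq_1)
    then have "A = A * X + fps_X * (A * X)"
      by (simp add: algebra_simps)
    then have "fps_nth A (Suc d) = fps_nth (A * X + fps_X * (A * X)) (Suc d)"
      by simp
    then show ?thesis by simp
  qed
  define p where "p d = - fps_nth N d / \<tau>\<^sup>2" for d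
  define q where "q d = \<i> * fps_nth G d / \<tau>" for d
  define r where "r d = fps_nth Y d / \<tau>\<^sup>2" for d
  have G0: "fps_nth G 0 = 0" and Y0: "fps_nth Y 0 = 0" and N0: "fps_nth N 0 = 0"
    using F0 by (simp_all add: G_def Y_def N_def)
  show ?thesis
  proof (rule that[of "\<tau>\<^sup>2" a h r p q])
    show "\<tau>\<^sup>2 \<noteq> 0" using \<tau>0 by simp
    show "a 0 = 1" using A01(3) \<tau>0 by (simp add: a_def numeral_2_eq_2)
    show "h 0 = 0" using AX[of 0] AX0 A01 by (simp add: h_def)
    show "h (Suc d) = a d - h d" for d
      using AX[of "Suc d"] by (simp add: h_def a_def diff_divide_distrib)
    \<comment> \<open>\<open>G\<close> vanishes at the horizon, so \<open>G\<^sup>2\<close> starts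
      in degree 2 and \<open>Y\<close> keeps the nonzero slope of \<open>- F1\<close>.\<close>
    have "fps_nth F1 1 \<noteq> 0" using F0 \<tau>0 by auto
    then show "r 1 \<noteq> 0"
      using \<tau>0 G0 by (simp add: r_def Y_def power2_eq_square fps_mult_nth)
    fix n k i j
    define \<sigma> :: complex where "\<sigma> = of_nat j - of_nat n / 2"
    have \<rho>: "- \<i> * (ps_freq \<Omega>H T n k - k * \<Omega>H) / (4 * pi * T) = - (of_nat n / 2)"
      using T by (simp add: ps_freq_def field_simps)
    have M: "KG_M f1 f2 f3 \<Omega>H T m (ps_freq \<Omega>H T n k) k (Suc i) (Suc j) =
      taylor_coeff (KG_A f1 f2) (int i - int j + 3) * \<sigma> * (\<sigma> - 1)
       + taylor_coeff (KG_B f1 f2) (int i - int j + 2) * \<sigma>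
       + taylor_coeff (KG_C f1 f3 m (ps_freq \<Omega>H T n k) k) (int i - int j + 1)"
      unfolding KG_M_def Let_def \<rho> \<sigma>_def by (simp add: algebra_simps)
    show "KG_M f1 f2 f3 \<Omega>H T m (ps_freq \<Omega>H T n k) k (Suc i) (Suc j) = \<tau>\<^sup>2 * frob_entry a h
        (\<lambda>d. if d = 0 then - (of_nat n)\<^sup>2 / 4 else p d + of_nat n * q d * k + r d * k\<^sup>2) n i j"
    proof (cases "Suc i < j")
      case True
      \<comment> \<open>Here the index is at most 1 for \<open>A\<close>, at most 0 for
        \<open>B\<close> and negative for \<open>C\<close>, where all coefficients vanish.\<close>
      have "nat (int i - int j + 3) \<le> 1" "nat (int i - int j + 2) = 0" using True by auto
      then show ?thesis
        using A01 AX0 True unfolding M taylor_coeff_eqI[OF A] taylor_coeff_eqI[OF B] taylor_coeff_eqI[OF C]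
        by (cases "nat (int i - int j + 3)") (auto simp: frob_entry_def)
    next
      case False
      define d where "d = Suc i - j"
      have idx: "int i - int j + 3 = int (d + 2)" "int i - int j + 2 = int (d + 1)"
        "int i - int j + 1 = int d"
        using False by (auto simp: d_def)
      have tA: "fps_nth A (Suc (Suc d)) = \<tau>\<^sup>2 * a d" and tH: "fps_nth (A * X) (Suc d) = \<tau>\<^sup>2 * h d"
        using \<tau>0 by (simp_all add: a_def h_def)
      have "fps_nth (fps_const (- \<tau>\<^sup>2 * (of_nat n)\<^sup>2 / 4) + fps_const (\<i> * \<tau> * of_nat n * k) * G
          + fps_const (k\<^sup>2) * Y - N) d =
        \<tau>\<^sup>2 * (if d = 0 then - (of_nat n)\<^sup>2 / 4 else p d + of_nat n * q d * k + r d * k\<^sup>2)"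
        using G0 N0 Y0 \<tau>0 by (simp add: p_def q_def r_def field_simps power2_eq_square)
      then have tC: "taylor_coeff (KG_C f1 f3 m (ps_freq \<Omega>H T n k) k) (int d) =
        \<tau>\<^sup>2 * (if d = 0 then - (of_nat n)\<^sup>2 / 4 else p d + of_nat n * q d * k + r d * k\<^sup>2)"
        unfolding taylor_coeff_eqI[OF C] by simp
      have tB: "taylor_coeff (KG_B f1 f2) (int (d + 1)) = \<tau>\<^sup>2 * (of_nat (d + 2) / 2 * a d - h d)"
        unfolding taylor_coeff_eqI[OF B] nat_int using tA tH by (simp add: algebra_simps)
      have tA': "taylor_coeff (KG_A f1 f2) (int (d + 2)) = \<tau>\<^sup>2 * a d"
        unfolding taylor_coeff_eqI[OF A] nat_int using tA by simp
      show ?thesis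
        unfolding M using False
        by (simp only: tA' tB tC idx frob_entry_def Let_def if_False
              d_def [symmetric] \<sigma>_def [symmetric]) (simp add: algebra_simps)
    qed
  qed
qed

section \<open>Normal form of the potential and of the determinant\<close>

text \<open>
  The coefficients \<open>V\<^sub>d\<close> expressed by those of \<open>a = A / (\<tau>\<^sup>2 (z-1)\<^sup>2)\<close> and \<open>c = C / \<tau>\<^sup>2\<close>: with \<open>x = z - 1\<close>,
  they are determined by \<open>V(y(x)) = c(x) + A'/(4 \<tau>\<^sup>2 z) - 3 A/(4 \<tau>\<^sup>2 z\<^sup>2)\<close> and \<open>y = x + O(x\<^sup>2)\<close>.
  Meaningful for \<open>1 \<le> d \<le> 4\<close> only.
\<close>

definition normal_potential :: "(nat \<Rightarrow> complex) \<Rightarrow> (nat \<Rightarrow> complex) \<Rightarrow> nat \<Rightarrow> complex" where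
  "normal_potential a c d =
     (if d = 1 then c 1 + 1/2
      else if d = 2 then c 2 + a 1 * c 1 / 2 + a 1 - 5/4
      else if d = 3 then c 3 + a 1 * c 2 + (a 2 / 4 + 3/16 * a 1 ^ 2) * c 1
        + 2 - 11/4 * a 1 + 9/8 * a 2 + 27/32 * a 1 ^ 2
      else c 4 + 3/2 * a 1 * c 3 + (a 2 / 2 + 5/8 * a 1 ^ 2) * c 2
        + (a 3 / 6 + a 1 * a 2 / 4 + a 1 ^ 3 / 16) * c 1
        - 11/4 + 21/4 * a 1 - 19/8 * a 2 + 4/3 * a 3 + 2 * a 1 * a 2 - 97/32 * a 1 ^ 2 + a 1 ^ 3 / 2)"

text \<open>
  The determinant of the \<open>n \<times> n\<close> matrix with entries \<open>V\<^bsub>K-S+1\<^esub>\<close> on and below the diagonal and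
  \<open>K (K - n)\<close> on the superdiagonal; meaningful for \<open>1 \<le> n \<le> 4\<close> only.
\<close>

definition normal_det :: "nat \<Rightarrow> (nat \<Rightarrow> 'a :: comm_ring_1) \<Rightarrow> 'a" where
  "normal_det n V =
     (if n = 1 then V 1
      else if n = 2 then V 2 + V 1 ^ 2
      else if n = 3 then 4 * V 3 + 4 * V 1 * V 2 + V 1 ^ 3
      else 36 * V 4 + 24 * V 1 * V 3 + 9 * V 2 ^ 2 + 10 * V 1 ^ 2 * V 2 + V 1 ^ 4)"

lemma normal_det_weighted_homogeneous:
  assumes "n \<in> {1, 2, 3, 4}"
  shows "normal_det n (\<lambda>d. s ^ d * V d) = s ^ n * normal_det n V"
  using assms by (auto simp: normal_det_def algebra_simps power2_eq_square power3_eq_cube power4_eq_xxxx)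

lemma poly_normal_det: "poly (normal_det n V) k = normal_det n (\<lambda>d. poly (V d) k)"
  by (simp add: normal_det_def)

text \<open>The change of variables enters only through the formulas in
  \<open>normal_potential\<close>: for each \<open>n\<close>, both sides are polynomials in the
  \<open>a d\<close> and \<open>c d\<close> and agree after expansion.\<close>

lemma det_frob_entry:
  fixes a h c :: "nat \<Rightarrow> complex"
  assumes "a 0 = 1" "h 0 = 0" "\<And>d. h (Suc d) = a d - h d" "c 0 = - (of_nat n)\<^sup>2 / 4"
    and "n \<in> {1, 2, 3, 4}"
  shows "Determinant.det (Matrix.mat n n (\<lambda>(i, j). frob_entry a h c n i j)) =
    normal_det n (normal_potential a c)"
proof -
  have [simp]: "h (Suc 0) = 1" "h 2 = a 1 - 1" "h 3 = a 2 - a 1 + 1" "h 4 = a 3 - a 2 + a 1 - 1"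
    using assms(3)[of 0] assms(3)[of 1] assms(3)[of 2] assms(3)[of 3] assms(1,2)
    by (simp_all add: numeral_eq_Suc)
  have d2: "Determinant.det (Matrix.mat 2 2 f) = f (0,0) * f (1,1) - f (0,1) * f (1,0)"
    for f :: "nat \<times> nat \<Rightarrow> complex"
    by (simp add: numeral_2_eq_2 det_mat_Suc)
  have d3: "Determinant.det (Matrix.mat 3 3 f) =
      f (0,0) * (f (1,1) * f (2,2) - f (1,2) * f (2,1)) - f (0,1) * (f (1,0) * f (2,2) - f (1,2) * f (2,0))
      + f (0,2) * (f (1,0) * f (2,1) - f (1,1) * f (2,0))" for f :: "nat \<times> nat \<Rightarrow> complex"
    by (simp add: numeral_eq_Suc det_mat_Suc lessThan_Suc algebra_simps)
  \<comment> \<open>The zeros above the superdiagonal leave two terms in each row expansion.\<close>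
  have d4: "Determinant.det (Matrix.mat 4 4 (\<lambda>(i, j). if Suc i < j then 0 else f i j)) =
      f 0 0 * (f 1 1 * (f 2 2 * f 3 3 - f 2 3 * f 3 2) - f 1 2 * (f 2 1 * f 3 3 - f 2 3 * f 3 1))
      - f 0 1 * (f 1 0 * (f 2 2 * f 3 3 - f 2 3 * f 3 2) - f 1 2 * (f 2 0 * f 3 3 - f 2 3 * f 3 0))"
    for f :: "nat \<Rightarrow> nat \<Rightarrow> complex"
    by (simp add: numeral_eq_Suc det_mat_Suc lessThan_Suc algebra_simps)
  define V where "V = normal_potential a c"
  consider "n = 1" | "n = 2" | "n = 3" | "n = 4"
    using assms(5) by blast
  then have "Determinant.det (Matrix.mat n n (\<lambda>(i, j). frob_entry a h c n i j)) = normal_det n V"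
  proof cases
    case 1
    then show ?thesis
      using assms(1,2,4) unfolding normal_det_def
      by (simp add: V_def det_mat_Suc frob_entry_def normal_potential_def) (simp add: field_simps)
  next
    case 2
    then show ?thesis
      using assms(1,2,4) unfolding normal_det_def
      by (simp add: V_def d2 frob_entry_def normal_potential_def Let_def numeral_2_eq_2[symmetric])
        (simp add: field_simps power2_eq_square)
  next
    case 3
    then show ?thesis
      using assms(1,2,4) unfolding normal_det_def
      by (simp add: V_def d3 frob_entry_def normal_potential_def Let_def numeral_2_eq_2[symmetric])
        (simp add: field_simps power2_eq_square power3_eq_cube)
  next
    case 4
    then show ?thesis
      using assms(1,2,4) unfolding normal_det_def frob_entry_def
      by (simp add: V_def d4 normal_potential_def Let_def numeral_2_eq_2[symmetric])
        (simp add: field_simps power2_eq_square power3_eq_cube power4_eq_xxxx)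
  qed
  then show ?thesis by (simp add: V_def)
qed

text \<open>\<open>normal_potential a c d\<close> is affine in \<open>c\<close> and independent of
  \<open>c 0\<close>. Its linear part \<open>L\<close> acts on \<open>p\<close>, \<open>q\<close>,
  \<open>r\<close> separately, and the inhomogeneous term joins \<open>P\<close>.\<close>

lemma normal_potential_quadratic:
  obtains P Q :: "nat \<Rightarrow> complex" and R where "R 1 = r 1"
    "\<And>n k d. d \<in> {1, 2, 3, 4} \<Longrightarrow> normal_potential a
      (\<lambda>d. if d = 0 then - (of_nat n)\<^sup>2 / 4 else p d + of_nat n * q d * k + r d * k\<^sup>2) d =
      P d + of_nat n * Q d * k + R d * k\<^sup>2"
proof -
  define L where "L c d = normal_potential a c d - normal_potential a (\<lambda>_. 0) d" for c d
  show ?thesis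
    by (rule that[of "L r" "normal_potential a p" "L q"])
      (auto simp: L_def normal_potential_def algebra_simps)
qed

lemma normal_det_cong:
  assumes "\<And>d. d \<in> {1, 2, 3, 4} \<Longrightarrow> V d = W d"
  shows "normal_det n V = normal_det n W"
  using assms by (simp add: normal_det_def)

lemma ps_det_normal_form:
  assumes "rotating_black_hole f1 f2 f3 \<Omega>H T"
  obtains p q r :: "nat \<Rightarrow> complex" and t :: complex
  where "t \<noteq> 0" "r 1 = 1"
    "\<And>n k. n \<in> {1, 2, 3, 4} \<Longrightarrow> ps_det f1 f2 f3 \<Omega>H T m n k =
       t ^ n * normal_det n (\<lambda>d. p d + of_nat n * q d * k + r d * k\<^sup>2)"
proof -
  obtain a h p q r :: "nat \<Rightarrow> complex" and t where *: "t \<noteq> 0" "a 0 = 1" "h 0 = 0"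
    "\<And>d. h (Suc d) = a d - h d" "r 1 \<noteq> 0"
    and M: "\<And>n k i j. KG_M f1 f2 f3 \<Omega>H T m (ps_freq \<Omega>H T n k) k (Suc i) (Suc j) =
       t * frob_entry a h
         (\<lambda>d. if d = 0 then - (of_nat n)\<^sup>2 / 4 else p d + of_nat n * q d * k + r d * k\<^sup>2) n i j"
    by (rule KG_M_eq_frob_entry[OF assms, of m]) (rule that)
  obtain P Q R where R: "R 1 = r 1" and V: "\<And>n k d. d \<in> {1, 2, 3, 4} \<Longrightarrow> normal_potential a
      (\<lambda>d. if d = 0 then - (of_nat n)\<^sup>2 / 4 else p d + of_nat n * q d * k + r d * k\<^sup>2) d =
      P d + of_nat n * Q d * k + R d * k\<^sup>2"
    by (rule normal_potential_quadratic[of r a p q]) (rule that)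
  show ?thesis
  \<comment> \<open>Dividing by \<open>r 1 ^ d\<close> is the rescaling of \<open>y\<close>; by
    weighted homogeneity it costs the factor \<open>r 1 ^ n\<close>, absorbed into
    \<open>t\<close>.\<close>
  proof (rule that[of "t * r 1" "\<lambda>d. R d / r 1 ^ d" "\<lambda>d. P d / r 1 ^ d" "\<lambda>d. Q d / r 1 ^ d"])
    fix n :: nat and k :: complex
    assume n: "n \<in> {1, 2, 3, 4}"
    define c where "c = (\<lambda>d. if d = 0 then - (of_nat n)\<^sup>2 / 4
      else p d + of_nat n * q d * k + r d * k\<^sup>2)"
    have mat: "Matrix.mat n n (\<lambda>(i, j). KG_M f1 f2 f3 \<Omega>H T m (ps_freq \<Omega>H T n k) k (Suc i) (Suc j)) =
        t \<cdot>\<^sub>m Matrix.mat n n (\<lambda>(i, j). frob_entry a h c n i j)"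
      by (rule eq_matI) (simp_all add: M c_def)
    have "ps_det f1 f2 f3 \<Omega>H T m n k = t ^ n * normal_det n (normal_potential a c)"
      using det_frob_entry[of a h c n] * n by (simp add: ps_det_def mat c_def)
    also have "normal_det n (normal_potential a c) = normal_det n (\<lambda>d. r 1 ^ d *
        (P d / r 1 ^ d + of_nat n * (Q d / r 1 ^ d) * k + R d / r 1 ^ d * k\<^sup>2))"
      using V[of _ n k] \<open>r 1 \<noteq> 0\<close> by (intro normal_det_cong) (simp add: c_def algebra_simps)
    finally show "ps_det f1 f2 f3 \<Omega>H T m n k = (t * r 1) ^ n * normal_det n (\<lambda>d.
        P d / r 1 ^ d + of_nat n * (Q d / r 1 ^ d) * k + R d / r 1 ^ d * k\<^sup>2)"
      unfolding normal_det_weighted_homogeneous[OF n] by (simp add: power_mult_distrib)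
  qed (use * R in auto)
qed

section \<open>Coefficients in \<open>k\<close> and elimination of the parameters\<close>

lemma coeff_pCons_numeral:
  "coeff (pCons a p) (numeral w) = coeff p (pred_numeral w)"
  by (simp add: numeral_eq_Suc)

text \<open>\<open>D n\<close> is monic because only the monomial \<open>V 1 ^ n\<close> reaches
  degree \<open>2 * n\<close> in \<open>k\<close>. The coefficients listed are those behind the
  \<open>E n l\<close> in the constraints.\<close>

lemma coeff_normal_det_quadratic:
  fixes p q r :: "nat \<Rightarrow> complex"
  assumes "r 1 = 1"
  defines "D \<equiv> \<lambda>n. normal_det n (\<lambda>d. [:p d, of_nat n * q d, r d:])"
  shows "lead_coeff (D 1) = 1" "degree (D 1) = 2"
      "coeff (D 1) 1 = q 1"
      "coeff (D 1) 0 = p 1"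
    and "lead_coeff (D 2) = 1" "degree (D 2) = 4"
      "coeff (D 2) 3 = 4 * q 1"
      "coeff (D 2) 2 = 2 * p 1 + r 2 + 4 * q 1 ^ 2"
      "coeff (D 2) 1 = 2 * q 2 + 4 * p 1 * q 1"
      "coeff (D 2) 0 = p 2 + p 1 ^ 2"
    and "lead_coeff (D 3) = 1" "degree (D 3) = 6"
      "coeff (D 3) 5 = 9 * q 1"
      "coeff (D 3) 4 = 3 * p 1 + 4 * r 2 + 27 * q 1 ^ 2"
      "coeff (D 3) 3 = 12 * q 2 + 18 * p 1 * q 1 + 12 * q 1 * r 2 + 27 * q 1 ^ 3"
      "coeff (D 3) 2 = 4 * p 2 + 4 * r 3 + 4 * p 1 * r 2 + 3 * p 1 ^ 2 + 36 * q 1 * q 2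
        + 27 * p 1 * q 1 ^ 2"
      "coeff (D 3) 1 = 12 * q 3 + 12 * p 1 * q 2 + 12 * p 2 * q 1 + 9 * p 1 ^ 2 * q 1"
    and "lead_coeff (D 4) = 1" "degree (D 4) = 8"
      "coeff (D 4) 7 = 16 * q 1"
      "coeff (D 4) 6 = 4 * p 1 + 10 * r 2 + 96 * q 1 ^ 2"
      "coeff (D 4) 5 = 40 * q 2 + 48 * p 1 * q 1 + 80 * q 1 * r 2 + 256 * q 1 ^ 3"
      "coeff (D 4) 4 = 10 * p 2 + 24 * r 3 + 20 * p 1 * r 2 + 6 * p 1 ^ 2 + 320 * q 1 * q 2
        + 9 * r 2 ^ 2 + 192 * p 1 * q 1 ^ 2 + 160 * q 1 ^ 2 * r 2 + 256 * q 1 ^ 4"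
      "coeff (D 4) 3 = 96 * q 3 + 80 * p 1 * q 2 + 80 * p 2 * q 1 + 96 * q 1 * r 3
        + 72 * q 2 * r 2 + 80 * p 1 * q 1 * r 2 + 48 * p 1 ^ 2 * q 1 + 640 * q 1 ^ 2 * q 2
        + 256 * p 1 * q 1 ^ 3"
  using assms(1)
  by (simp_all add: D_def normal_det_def numeral_poly power2_eq_square power3_eq_cube power4_eq_xxxx
      coeff_pCons_numeral algebra_simps)

theorem mainTheorem8:
  fixes f1 f2 f3 :: "complex \<Rightarrow> complex" and \<Omega>H m :: complex and T :: real
  assumes "rotating_black_hole f1 f2 f3 \<Omega>H T"
  shows "let E = ps_E f1 f2 f3 \<Omega>H T m in
      E 2 1 - 4 * E 1 1 = 0
    \<and> E 3 1 - 9 * E 1 1 = 0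
    \<and> E 3 2 - 4 * E 2 2 - 11 * E 1 1 ^ 2 + 5 * E 1 2 = 0
    \<and> E 3 3 - 6 * E 2 3 - 12 * E 1 1 * E 2 2 + 30 * E 1 1 * E 1 2 + 21 * E 1 1 ^ 3 = 0
    \<and> E 4 1 - 16 * E 1 1 = 0
    \<and> E 4 2 - 10 * E 2 2 - 56 * E 1 1 ^ 2 + 16 * E 1 2 = 0
    \<and> E 4 3 - 20 * E 2 3 + 192 * E 1 1 * E 1 2 - 80 * E 1 1 * E 2 2 + 64 * E 1 1 ^ 3 = 0
    \<and> E 4 4 - 6 * E 3 4 + 40 * E 1 2 * E 2 2 - 9 * E 2 2 ^ 2 - 52 * E 1 1 * E 2 3 + 14 * E 2 4
      + 240 * E 1 1 ^ 4 + 338 * E 1 1 ^ 2 * E 1 2 - 46 * E 1 2 ^ 2 - 88 * E 1 1 ^ 2 * E 2 2 = 0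
    \<and> E 4 5 - 8 * E 3 5 - 696 * E 1 1 ^ 3 * E 1 2 - 368 * E 1 1 * E 1 2 ^ 2
      + 160 * E 1 1 * E 1 2 * E 2 2 + 256 * E 1 1 ^ 2 * E 2 3 + 80 * E 1 2 * E 2 3
      - 36 * E 2 2 * E 2 3 + 112 * E 1 1 * E 2 4 - 24 * E 1 1 * E 3 4 = 0"
proof -
  obtain p q r :: "nat \<Rightarrow> complex" and t :: complex where t: "t \<noteq> 0" and r: "r 1 = 1"
    and det: "\<And>n k. n \<in> {1, 2, 3, 4} \<Longrightarrow> ps_det f1 f2 f3 \<Omega>H T m n k =
       t ^ n * normal_det n (\<lambda>d. p d + of_nat n * q d * k + r d * k\<^sup>2)"
    by (rule ps_det_normal_form[OF assms, of m]) (rule that)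
  define D where "D n = normal_det n (\<lambda>d. [:p d, of_nat n * q d, r d:])" for n
  note coeffs = coeff_normal_det_quadratic[of r p q, OF r, folded D_def]
  have ps_E: "ps_E f1 f2 f3 \<Omega>H T m n l = (-1) ^ l * coeff (D n) (2 * n - l)"
    if "n \<in> {1, 2, 3, 4}" "l \<le> 2 * n" for n l
  proof -
    have D: "lead_coeff (D n) = 1" "degree (D n) = 2 * n"
      using that(1) coeffs by auto
    show ?thesis
      using ps_E_eq[of "t ^ n" f1 f2 f3 \<Omega>H T m n "D n" l] t that(2) D
      by (simp add: det[OF that(1)] D_def poly_normal_det power2_eq_square algebra_simps)
  qed
  define E where "E = ps_E f1 f2 f3 \<Omega>H T m"
  \<comment> \<open>Seven values, \<open>E 1 1\<close>, \<open>E 1 2\<close>, \<open>E 2 2\<close>,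
    \<open>E 2 3\<close>, \<open>E 2 4\<close>, \<open>E 3 4\<close>, \<open>E 3 5\<close>,
    determine the seven parameters \<open>q 1\<close>, \<open>p 1\<close>, \<open>r 2\<close>,
    \<open>q 2\<close>, \<open>p 2\<close>, \<open>r 3\<close>, \<open>q 3\<close>. The other nine
    give one constraint each.\<close>
  have E:
    "E 1 1 = - q 1"
    "E 1 2 = p 1"
    "E 2 1 = - 4 * q 1"
    "E 2 2 = 2 * p 1 + r 2 + 4 * q 1 ^ 2"
    "E 2 3 = - 2 * q 2 - 4 * p 1 * q 1"
    "E 2 4 = p 2 + p 1 ^ 2"
    "E 3 1 = - 9 * q 1"
    "E 3 2 = 3 * p 1 + 4 * r 2 + 27 * q 1 ^ 2"
    "E 3 3 = - 12 * q 2 - 18 * p 1 * q 1 - 12 * q 1 * r 2 - 27 * q 1 ^ 3"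
    "E 3 4 = 4 * p 2 + 4 * r 3 + 4 * p 1 * r 2 + 3 * p 1 ^ 2 + 36 * q 1 * q 2
        + 27 * p 1 * q 1 ^ 2"
    "E 3 5 = - 12 * q 3 - 12 * p 1 * q 2 - 12 * p 2 * q 1 - 9 * p 1 ^ 2 * q 1"
    "E 4 1 = - 16 * q 1"
    "E 4 2 = 4 * p 1 + 10 * r 2 + 96 * q 1 ^ 2"
    "E 4 3 = - 40 * q 2 - 48 * p 1 * q 1 - 80 * q 1 * r 2 - 256 * q 1 ^ 3"
    "E 4 4 = 10 * p 2 + 24 * r 3 + 20 * p 1 * r 2 + 6 * p 1 ^ 2 + 320 * q 1 * q 2
        + 9 * r 2 ^ 2 + 192 * p 1 * q 1 ^ 2 + 160 * q 1 ^ 2 * r 2 + 256 * q 1 ^ 4"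
    "E 4 5 = - 96 * q 3 - 80 * p 1 * q 2 - 80 * p 2 * q 1 - 96 * q 1 * r 3 - 72 * q 2 * r 2
        - 80 * p 1 * q 1 * r 2 - 48 * p 1 ^ 2 * q 1 - 640 * q 1 ^ 2 * q 2
        - 256 * p 1 * q 1 ^ 3"
    by (simp_all add: E_def ps_E coeffs[unfolded One_nat_def])
  show ?thesis
    unfolding Let_def E_def [symmetric] E
    by (intro conjI; simp add: power2_eq_square power3_eq_cube power4_eq_xxxx algebra_simps)
qed

end
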